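(* Suppose that $n \sim 3n+2$ for every $n \in \mathbb{N}\setminus 2^{\mathbb{N}}$. Then $n \equiv \mathcal{R}$ for every $n \in \mathbb{N}\setminus 2^{\mathbb{N}}$.
   Context: $\mathbb{N}$ is the set of positive integers and $2^{\mathbb{N}}=\{2,2^2,2^3,\dots\}$. The Collatz function $T:\mathbb{N}\to\mathbb{N}$ is defined by $T(n)=n/2$ if $n$ is even and $T(n)=3n+1$ if $n$ is odd; $T^k$ denotes the $k$-fold composition of $T$. The forward orbit of $n\in\mathbb{N}$ is $O^+(n)=\{n,T(n),T^2(n),\dots\}$. For $n_1,n_2\in\mathbb{N}$, write $n_1\sim n_2$ if and only if $O^+(n_1)\cap O^+(n_2)\neq\emptyset$. For $m\in\mathbb{N}$, write $m\equiv\mathcal{R}$ if and only if there exist an integer $k\ge 0$ and integers $0\le a_0\le a_1\le\cdots\le a_{k+1}$ such that $$m=\left(2^{a_{k+1}}-\sum_{i=0}^{k}2^{a_i}3^{k-i}\right)/3^{k+1}.$$ *)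

theory Defs
  imports Complex_Main
begin

(* The positive integers are the n :: nat with 0 < n; collatz maps them to themselves. *)

definition collatz :: "nat \<Rightarrow> nat" where
  "collatz n = (if even n then n div 2 else 3 * n + 1)"

definition forward_orbit :: "nat \<Rightarrow> nat set" where
  "forward_orbit n = {(collatz ^^ k) n | k. True}"

definition collatz_sim :: "nat \<Rightarrow> nat \<Rightarrow> bool" (infix "\<sim>\<^sub>C" 50) where
  "n1 \<sim>\<^sub>C n2 \<longleftrightarrow> forward_orbit n1 \<inter> forward_orbit n2 \<noteq> {}"

(* The exponent is at least 1: the number 1 is not a member. *)
definition powers_of_two :: "nat set" where
  "powers_of_two = {2 ^ j | j. 1 \<le> j}"

(* The exponents a_0, ..., a_{k+1} are the values of a on {0..k+1}; other values are irrelevant.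
   The equation is stated in the reals, so that neither subtraction nor division truncates. *)
definition R_representable :: "nat \<Rightarrow> bool" where
  "R_representable m \<longleftrightarrow>
     (\<exists>(k::nat) (a :: nat \<Rightarrow> nat).
        (\<forall>i\<le>k. a i \<le> a (i + 1)) \<and>
        real m = (2 ^ a (k + 1) - (\<Sum>i=0..k. 2 ^ a i * 3 ^ (k - i))) / 3 ^ (k + 1))"

end

(* The hypothesis yields the Collatz conjecture. For odd n = 2q + 1 we have T(T n) = 3q + 2, so
   n ~ q unless q is a power of two; together with T(2q) = q every n reduces to floor(n/2). In the
   exceptional case n = 8s + 1 with s a power of two (or n = 5), T^3 n = 6s + 1 = 2(3s) + 1, which
   reduces to 3s. Finally, recording the number of halvings before each odd step on the way from n
   to 1 gives the exponents a_i, as soon as there is at least one odd step. *)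

theory Submission
  imports Defs
begin

definition reaches_one :: "nat \<Rightarrow> bool" where
  "reaches_one n \<longleftrightarrow> (\<exists>k. (collatz ^^ k) n = 1)"

lemma reaches_one_collatz: "reaches_one (collatz n) \<longleftrightarrow> reaches_one n"
proof
  assume "reaches_one (collatz n)"
  then obtain k where "(collatz ^^ k) (collatz n) = 1"
    by (auto simp: reaches_one_def)
  then have "(collatz ^^ Suc k) n = 1"
    by (simp only: funpow_Suc_right o_apply)
  then show "reaches_one n"
    unfolding reaches_one_def by blast
next
  assume "reaches_one n"
  then obtain k where k: "(collatz ^^ k) n = 1"
    by (auto simp: reaches_one_def)
  show "reaches_one (collatz n)"
  proof (cases k)
    case 0
    \<comment> \<open>Here n = 1, and the cycle 1, 4, 2, 1 returns to 1 two steps after 4.\<close>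
    with k have "(collatz ^^ Suc (Suc 0)) (collatz n) = 1"
      by (simp add: collatz_def)
    then show ?thesis
      unfolding reaches_one_def by blast
  next
    case (Suc l)
    with k have "(collatz ^^ l) (collatz n) = 1"
      by (simp only: funpow_Suc_right o_apply)
    then show ?thesis
      unfolding reaches_one_def by blast
  qed
qed

lemma reaches_one_funpow: "reaches_one ((collatz ^^ k) n) \<longleftrightarrow> reaches_one n"
  by (induction k) (simp_all add: reaches_one_collatz)

text \<open>Both orbits pass through a common iterate, and reaching 1 carries over along an orbit in
  both directions.\<close>

lemma reaches_one_sim:
  assumes "m \<sim>\<^sub>C n"
  shows "reaches_one m \<longleftrightarrow> reaches_one n"
proof -
  obtain i j where "(collatz ^^ i) m = (collatz ^^ j) n"
    using assms by (auto simp: collatz_sim_def forward_orbit_def)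
  then show ?thesis
    by (metis reaches_one_funpow)
qed

lemma reaches_one_double: "reaches_one (2 * n) \<longleftrightarrow> reaches_one n"
  using reaches_one_collatz[of "2 * n"] by (simp add: collatz_def)

lemma reaches_one_odd: "odd n \<Longrightarrow> reaches_one n \<longleftrightarrow> reaches_one (3 * n + 1)"
  using reaches_one_collatz[of n] by (simp add: collatz_def)

lemma reaches_one_double_plus_one: "reaches_one (2 * n + 1) \<longleftrightarrow> reaches_one (3 * n + 2)"
proof -
  have "3 * (2 * n + 1) + 1 = 2 * (3 * n + 2)"
    by simp
  then show ?thesis
    using reaches_one_odd[of "2 * n + 1"] reaches_one_double[of "3 * n + 2"]
    by (simp only: even_plus_one_iff) simp
qed

text \<open>Makes the hypothesis n ~ 3n + 2 available at 3s in the exceptional case.\<close>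

lemma three_mult_notin_powers_of_two: "3 * n \<notin> powers_of_two"
proof
  assume "3 * n \<in> powers_of_two"
  then obtain j where "3 * n = 2 ^ j"
    by (auto simp: powers_of_two_def)
  then have "3 dvd (2::nat) ^ j"
    by (metis dvd_triv_left)
  moreover have "coprime (3::nat) (2 ^ j)"
    by simp
  ultimately show False
    using coprime_absorb_left[of "3::nat" "2 ^ j"] by simp
qed

lemma all_reach_one:
  assumes hyp: "\<And>n. 0 < n \<Longrightarrow> n \<notin> powers_of_two \<Longrightarrow> n \<sim>\<^sub>C 3 * n + 2"
    and "0 < n"
  shows "reaches_one n"
  using \<open>0 < n\<close>
proof (induction n rule: less_induct)
  case (less n)
  \<comment> \<open>By induction q reaches 1, hence so does 3q + 2 by the hypothesis, and 3q + 2
    lies on the orbit of 2q + 1.\<close>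
  have step: "reaches_one (2 * q + 1)" if "0 < q" "q \<notin> powers_of_two" "q < n" for q
    using that less.IH hyp[of q] reaches_one_sim reaches_one_double_plus_one by blast
  have one: "reaches_one 1"
    unfolding reaches_one_def by (rule exI[of _ 0]) simp
  show ?case
  proof (cases "even n")
    case True
    then obtain q where "n = 2 * q" by blast
    with less show ?thesis
      by (simp add: reaches_one_double)
  next
    case False
    then obtain q where q: "n = 2 * q + 1"
      by (blast elim: oddE)
    \<comment> \<open>A power of two here is 2 or a multiple of 4. That s is again a power of two is
      not recorded, since only 3s matters.\<close>
    consider "q = 0" | "0 < q" "q \<notin> powers_of_two" | "q = 2"
      | s where "q = 4 * s" "0 < s"
    proof (cases "q \<in> powers_of_two")
      case True
      then obtain i where i: "q = 2 ^ i" "1 \<le> i"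
        by (auto simp: powers_of_two_def)
      show ?thesis
      proof (cases "i = 1")
        case True
        with i that(3) show ?thesis by simp
      next
        case False
        with i have "i = Suc (Suc (i - 2))" by simp
        with i have "q = 4 * 2 ^ (i - 2)"
          by (metis mult.assoc numeral_Bit0_eq_double power_Suc)
        with that(4) show ?thesis by simp
      qed
    qed (use that(1,2) in blast)
    then show ?thesis
    proof cases
      case 1
      with q one show ?thesis by simp
    next
      case 2
      with q step show ?thesis by simp
    next
      case 3
      \<comment> \<open>For n = 5 the number 3q + 2 is 8.\<close>
      have "reaches_one (2 * (2 * (2 * 1)))"
        using one by (simp only: reaches_one_double)
      with 3 q show ?thesis
        using reaches_one_double_plus_one[of 2] by simp
    next
      case (4 s)
      \<comment> \<open>\<open>step\<close> applies at 3s because 3s < 8s + 1 = n.\<close>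
      have "reaches_one (2 * (3 * s) + 1)"
        using 4 q by (intro step three_mult_notin_powers_of_two) auto
      then have "reaches_one (2 * (2 * (3 * s) + 1))"
        by (simp only: reaches_one_double)
      also have "2 * (2 * (3 * s) + 1) = 3 * q + 2"
        using 4 by simp
      finally show ?thesis
        unfolding q reaches_one_double_plus_one .
    qed
  qed
qed

text \<open>Clearing the denominator and moving the sum to the left gives an identity in the
  naturals without subtraction.\<close>

lemma R_representable_iff:
  "R_representable m \<longleftrightarrow>
    (\<exists>k a. (\<forall>i\<le>k. a i \<le> a (i + 1)) \<and>
      3 ^ (k + 1) * m + (\<Sum>i=0..k. 2 ^ a i * 3 ^ (k - i)) = 2 ^ a (k + 1))"
proof -
  have "real m = (2 ^ p - (\<Sum>i=0..k. 2 ^ a i * 3 ^ (k - i))) / 3 ^ (k + 1) \<longleftrightarrow>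
      3 ^ (k + 1) * m + (\<Sum>i=0..k. 2 ^ a i * 3 ^ (k - i)) = 2 ^ p" for k p a
  proof -
    have "real m = (2 ^ p - (\<Sum>i=0..k. 2 ^ a i * 3 ^ (k - i))) / 3 ^ (k + 1) \<longleftrightarrow>
        real (3 ^ (k + 1) * m + (\<Sum>i=0..k. 2 ^ a i * 3 ^ (k - i))) = real (2 ^ p)"
      by (simp add: eq_divide_eq algebra_simps)
    then show ?thesis
      by (simp only: of_nat_eq_iff)
  qed
  then show ?thesis
    unfolding R_representable_def by simp
qed

text \<open>The last odd step, followed by p halvings down to 1: k = 0, with exponents 0 and
  p.\<close>

lemma R_representable_base:
  assumes "3 * m + 1 = 2 ^ p"
  shows "R_representable m"
  unfolding R_representable_iff
  by (rule exI[of _ 0], rule exI[of _ "\<lambda>i. if i = 0 then 0 else p"]) (use assms in simp)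

text \<open>One more halving at the start raises every exponent by 1.\<close>

lemma R_representable_double:
  assumes "R_representable m"
  shows "R_representable (2 * m)"
proof -
  obtain k a where mono: "\<forall>i\<le>k. a i \<le> a (i + 1)"
    and eq: "3 ^ (k + 1) * m + (\<Sum>i=0..k. 2 ^ a i * 3 ^ (k - i)) = 2 ^ a (k + 1)"
    using assms unfolding R_representable_iff by blast
  have "3 ^ (k + 1) * (2 * m) + (\<Sum>i=0..k. 2 ^ (a i + 1) * 3 ^ (k - i)) =
      2 * (3 ^ (k + 1) * m + (\<Sum>i=0..k. 2 ^ a i * 3 ^ (k - i)))"
    by (simp add: sum_distrib_left algebra_simps)
  also have "\<dots> = 2 ^ (a (k + 1) + 1)"
    unfolding eq by simp
  finally show ?thesis
    unfolding R_representable_iff using mono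
    by (intro exI[of _ k] exI[of _ "\<lambda>i. a i + 1"]) simp
qed

lemma R_representable_triple_plus_one:
  assumes "R_representable (3 * m + 1)"
  shows "R_representable m"
proof -
  obtain k a where mono: "\<forall>i\<le>k. a i \<le> a (i + 1)"
    and eq: "3 ^ (k + 1) * (3 * m + 1) + (\<Sum>i=0..k. 2 ^ a i * 3 ^ (k - i)) = 2 ^ a (k + 1)"
    using assms unfolding R_representable_iff by blast
  \<comment> \<open>A new odd step comes before all recorded halvings, so 0 is prepended to the
    exponents. Its term 2^0 * 3^(k+1) absorbs the +1 of 3m + 1.\<close>
  define b where "b = case_nat 0 a"
  have "(\<Sum>i=0..Suc k. 2 ^ b i * 3 ^ (Suc k - i)) =
      3 ^ (k + 1) + (\<Sum>i=0..k. 2 ^ a i * (3::nat) ^ (k - i))"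
    by (subst sum.atLeast0_atMost_Suc_shift) (simp add: b_def)
  with eq have "3 ^ (Suc k + 1) * m + (\<Sum>i=0..Suc k. 2 ^ b i * 3 ^ (Suc k - i)) =
      2 ^ b (Suc k + 1)"
    by (simp add: b_def algebra_simps)
  moreover have "\<forall>i\<le>Suc k. b i \<le> b (i + 1)"
    using mono by (auto simp: b_def split: nat.split)
  ultimately show ?thesis
    unfolding R_representable_iff by blast
qed

text \<open>The orbit is traced back from 1: the number stays a power of two until an odd step 3n +
  1 = 2^j starts a representation, which every earlier step extends.\<close>

lemma funpow_collatz_one_imp:
  assumes "(collatz ^^ k) n = 1"
  shows "R_representable n \<or> (\<exists>j. n = 2 ^ j)"
  using assms
proof (induction k arbitrary: n)
  case 0
  then have "n = 2 ^ 0" by simp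
  then show ?case by blast
next
  case (Suc k)
  then have IH: "R_representable (collatz n) \<or> (\<exists>j. collatz n = 2 ^ j)"
    by (simp only: funpow_Suc_right o_apply)
  show ?case
  proof (cases "even n")
    case True
    then obtain q where "n = 2 * q" by blast
    with IH show ?thesis
      by (simp add: collatz_def) (metis R_representable_double power_Suc)
  next
    case False
    with IH show ?thesis
      by (simp add: collatz_def)
        (metis R_representable_base R_representable_triple_plus_one Suc_eq_plus1)
  qed
qed

theorem theorem3p1:
  assumes "\<forall>n::nat. 0 < n \<and> n \<notin> powers_of_two \<longrightarrow> n \<sim>\<^sub>C 3 * n + 2"
  shows "\<forall>n::nat. 0 < n \<and> n \<notin> powers_of_two \<longrightarrow> R_representable n"
proof (intro allI impI)
  fix n :: nat
  assume n: "0 < n \<and> n \<notin> powers_of_two"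
  then obtain k where "(collatz ^^ k) n = 1"
    using all_reach_one assms unfolding reaches_one_def by blast
  then consider "R_representable n" | j where "n = 2 ^ j"
    using funpow_collatz_one_imp by blast
  then show "R_representable n"
  proof cases
    case (2 j)
    \<comment> \<open>Since \<open>powers_of_two\<close> omits 1, the case n = 1 remains; it is
      represented by going once round the cycle, 3 * 1 + 1 = 2^2.\<close>
    with n have "j = 0"
      by (auto simp: powers_of_two_def not_less_eq_eq)
    with 2 show ?thesis
      using R_representable_base[of 1 2] by simp
  qed
qed

end
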